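(* Let $A$ be a graded superring, $B$ a graded subring, $\alpha$ an automorphism of $A$, $\beta$ an automorphism of $B$, $\lambda\in\Lambda$, $\pi\in\mathbb{Z}_2$. Let $A$ be an $(\alpha,\beta)$-Frobenius extension of $B$ of degree $(-\lambda,\pi)$ and let $\mathrm{tr}\colon{}^{\beta}_{B}A^{\alpha}_{B}\to\{\lambda,\pi\}{}_BB_B$ be a trace map. Then a second map $\mathrm{tr}'\colon{}^{\beta}_{B}A^{\alpha}_{B}\to\{\lambda,\pi\}{}_BB_B$ is also a trace map if and only if there exists an invertible element $a\in C_A(\alpha(B))$ of degree $(0,0)$ such that $\mathrm{tr}'=\mathrm{tr}\circ{}^{r}a$.
   Context: Fix an abelian group $\Lambda$. A graded superring is an associative unital $\Lambda\times\mathbb{Z}_2$-graded ring; subrings are graded (with the same unit), automorphisms preserve the grading, and modules and bimodules are $\Lambda\times\mathbb{Z}_2$-graded. For homogeneous $v$, $|v|\in\Lambda$ and $\bar v\in\mathbb{Z}_2$ denote its degrees; formulas involving degrees are stated for homogeneous elements and extended additively. Homomorphisms of modules and bimodules are additive maps of degree $(0,0)$ commuting strictly with the actions. Shifts: $\{\mu,\gamma\}M$ is $M$ as an abelian group, with $(\{\mu,\gamma\}M)_{\nu,\delta}=M_{\nu-\mu,\delta+\gamma}$, unchanged right action, and left action $a\cdot\{\mu,\gamma\}m=(-1)^{\gamma\bar a}\{\mu,\gamma\}(am)$. Twists: ${}^{\beta}_{B}A^{\alpha}_{A}$ is $A$ as a graded abelian group with $b\cdot x=\beta(b)x$ ($b\in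 B$) and $x\cdot a=x\alpha(a)$ ($a\in A$); ${}^{\beta}_{B}A^{\alpha}_{B}$ and ${}^{\beta}_{B}A$ are obtained by restricting, resp. forgetting, the right action. For $a\in A$, ${}^{r}a\colon A\to A$ is ${}^{r}a(x)=(-1)^{\bar a\bar x}xa$ (ordinary multiplication in $A$). For a subring $S$ of $A$, $C_A(S)=\{a\in A\mid as=(-1)^{\bar a\bar s}sa\ \forall s\in S\}$. $\mathrm{HOM}^{\mathrm L}_B({}^{\beta}_{B}A,\{\lambda,\pi\}{}_BB)$ is the direct sum over $(\mu,\gamma)\in\Lambda\times\mathbb{Z}_2$ of the groups of additive maps $f\colon A\to\{\lambda,\pi\}B$ of degree $(\mu,\gamma)$ with $f(\beta(b)x)=(-1)^{\gamma\bar b}\,b\cdot f(x)$ (action in $\{\lambda,\pi\}B$). The same group, denoted $\mathrm{HOM}^{\mathrm L}_B({}^{\beta}_{B}A^{\alpha}_{A},\{\lambda,\pi\}{}_BB_B)$, is an $(A,B)$-bimodule via $(a\cdot f)(x)=(-1)^{\bar a\bar f+\bar a\bar x}f(x\alpha(a))$ and $(f\cdot b)(x)=(-1)^{\bar b\bar x}f(x)b$. $A$ is an $(\alpha,\beta)$-Frobenius extension of $B$ of degree $(-\lambda,\pi)$ if (L1) $A$ is finitely generated and projective as a left $B$-module, and (L2) ${}_AA_B\cong\mathrm{HOM}^{\mathrm L}_B({}^{\beta}_{B}A^{\alpha}_{A},\{\lambda,\pi\}{}_BB_B)$ as $(A,B)$-bimodules. A trace map (= left $(\alpha,\beta)$-trace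 map of degree $(-\lambda,\pi)$) is a homomorphism of $(B,B)$-bimodules $\mathrm{tr}\colon{}^{\beta}_{B}A^{\alpha}_{B}\to\{\lambda,\pi\}{}_BB_B$ such that (L3) if $\mathrm{tr}(Aa)=0$ for some $a\in A$ then $a=0$, and (L4) for every $\varphi\in\mathrm{HOM}^{\mathrm L}_B({}^{\beta}_{B}A,\{\lambda,\pi\}{}_BB)$ there is $a\in A$ with $\varphi=\mathrm{tr}\circ{}^{r}a$. *)

theory Defs
  imports Main "HOL-Library.Z2" "HOL-Library.Product_Plus" "HOL-Library.Function_Algebras"
begin

text \<open>
  Rings are types of sort \<open>{ring, monoid_mult}\<close>, i.e. associative unital rings; unlike
  \<open>ring_1\<close> this sort does not exclude the zero ring.  A graded abelian group is given by
  its homogeneous parts, a family of subgroups of an ambient type of class \<open>ab_group_add\<close>.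
  The group \<open>\<Lambda>\<close> is a type \<open>'l\<close> of class \<open>ab_group_add\<close>, and \<open>\<int>\<^sub>2\<close> is the type \<open>bit\<close>.
\<close>

type_synonym 'l deg = "'l \<times> bit"

abbreviation parity :: "'l deg \<Rightarrow> bit" where
  "parity d \<equiv> snd d"

text \<open>\<open>koszul \<gamma> v\<close> is \<open>(-1)\<^sup>\<gamma> v\<close>.\<close>

definition koszul :: "bit \<Rightarrow> 'm::ab_group_add \<Rightarrow> 'm" where
  "koszul \<gamma> v = (if \<gamma> = 0 then v else - v)"


section \<open>Graded abelian groups\<close>

definition decomposition :: "('d \<Rightarrow> 'm::ab_group_add set) \<Rightarrow> 'm \<Rightarrow> ('d \<Rightarrow> 'm) \<Rightarrow> bool" where
  "decomposition G x c \<longleftrightarrow>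
     (\<forall>d. c d \<in> G d) \<and> finite {d. c d \<noteq> 0} \<and> x = (\<Sum>d | c d \<noteq> 0. c d)"

definition total :: "('d \<Rightarrow> 'm::ab_group_add set) \<Rightarrow> 'm set" where
  "total G = {x. \<exists>c. decomposition G x c}"

definition graded_group :: "('d \<Rightarrow> 'm::ab_group_add set) \<Rightarrow> bool" where
  "graded_group G \<longleftrightarrow>
     (\<forall>d. 0 \<in> G d \<and> (\<forall>x\<in>G d. \<forall>y\<in>G d. x - y \<in> G d)) \<and>
     (\<forall>x\<in>total G. \<exists>!c. decomposition G x c)"

definition hcomp :: "('d \<Rightarrow> 'm::ab_group_add set) \<Rightarrow> 'd \<Rightarrow> 'm \<Rightarrow> 'm" where
  "hcomp G d x = (if x \<in> total G then (THE c. decomposition G x c) d else 0)"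

text \<open>
  Additive extension to all of \<open>total G\<close> of an expression \<open>F d y\<close> stated for homogeneous \<open>y\<close>
  of degree \<open>d\<close>; it is used to read the formulas which involve degrees.
\<close>

definition homog_ext ::
  "('d \<Rightarrow> 'm::ab_group_add set) \<Rightarrow> 'm \<Rightarrow> ('d \<Rightarrow> 'm \<Rightarrow> 'n::ab_group_add) \<Rightarrow> 'n" where
  "homog_ext G x F = (\<Sum>d | hcomp G d x \<noteq> 0. F d (hcomp G d x))"

lemma decomposition_single:
  assumes "graded_group G" "x \<in> G d"
  shows "decomposition G x (\<lambda>e. if e = d then x else 0)"
proof -
  have "{e. (if e = d then x else 0) \<noteq> 0} = (if x = 0 then {} else {d})" by auto
  then show ?thesis using assms unfolding decomposition_def graded_group_def by auto
qed

lemma hcomp_homogeneous: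
  assumes "graded_group G" "x \<in> G d"
  shows "hcomp G e x = (if e = d then x else 0)"
proof -
  note D = decomposition_single[OF assms]
  then have t: "x \<in> total G" unfolding total_def by blast
  then have "\<exists>!c. decomposition G x c" using assms(1) unfolding graded_group_def by blast
  then have "(THE c. decomposition G x c) = (\<lambda>e. if e = d then x else 0)"
    using D by (simp add: the1_equality)
  then show ?thesis using t by (simp add: hcomp_def)
qed

lemma homog_ext_homogeneous:
  assumes "graded_group G" "x \<in> G d" "F d 0 = 0"
  shows "homog_ext G x F = F d x"
proof -
  have "{e. hcomp G e x \<noteq> 0} = (if x = 0 then {} else {d})"
    by (auto simp: hcomp_homogeneous[OF assms(1,2)])
  then show ?thesis using assms by (simp add: homog_ext_def hcomp_homogeneous[OF assms(1,2)])
qed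

definition additive_on :: "'m::ab_group_add set \<Rightarrow> ('m \<Rightarrow> 'n::ab_group_add) \<Rightarrow> bool" where
  "additive_on M f \<longleftrightarrow> (\<forall>x\<in>M. \<forall>y\<in>M. f (x + y) = f x + f y)"


section \<open>Graded superrings\<close>

definition graded_superring ::
  "('l::ab_group_add deg \<Rightarrow> 'a::{ring,monoid_mult} set) \<Rightarrow> bool" where
  "graded_superring G \<longleftrightarrow>
     graded_group G \<and> total G = UNIV \<and> 1 \<in> G 0 \<and>
     (\<forall>d e. \<forall>x\<in>G d. \<forall>y\<in>G e. x * y \<in> G (d + e))"

definition sub_grading ::
  "('l::ab_group_add deg \<Rightarrow> 'a::{ring,monoid_mult} set) \<Rightarrow> 'a set \<Rightarrow> 'l deg \<Rightarrow> 'a set" where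
  "sub_grading G B d = G d \<inter> B"

definition graded_subring ::
  "('l::ab_group_add deg \<Rightarrow> 'a::{ring,monoid_mult} set) \<Rightarrow> 'a set \<Rightarrow> bool" where
  "graded_subring G B \<longleftrightarrow>
     1 \<in> B \<and> (\<forall>x\<in>B. \<forall>y\<in>B. x - y \<in> B \<and> x * y \<in> B) \<and> total (sub_grading G B) = B"

definition graded_automorphism ::
  "('l::ab_group_add deg \<Rightarrow> 'a::{ring,monoid_mult} set) \<Rightarrow> ('a \<Rightarrow> 'a) \<Rightarrow> bool" where
  "graded_automorphism G f \<longleftrightarrow>
     bij_betw f (total G) (total G) \<and> additive_on (total G) f \<and> f 1 = 1 \<and>
     (\<forall>x\<in>total G. \<forall>y\<in>total G. f (x * y) = f x * f y) \<and>
     (\<forall>d. f ` G d \<subseteq> G d)"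

text \<open>\<open>rmult G a x\<close> is \<open>(-1)\<^bsup>|a||x|\<^esup> x a\<close> (with parities in the exponent).\<close>

definition rmult ::
  "('l::ab_group_add deg \<Rightarrow> 'a::{ring,monoid_mult} set) \<Rightarrow> 'a \<Rightarrow> 'a \<Rightarrow> 'a" where
  "rmult G a x =
     homog_ext G a (\<lambda>d a'. homog_ext G x (\<lambda>e x'. koszul (parity d * parity e) (x' * a')))"

lemma rmult_homogeneous:
  assumes "graded_group G" "a \<in> G d" "x \<in> G e"
  shows "rmult G a x = koszul (parity d * parity e) (x * a)"
proof -
  have i: "homog_ext G x (\<lambda>e x'. koszul (parity d * parity e) (x' * a')) =
     koszul (parity d * parity e) (x * a')" for a'
    by (rule homog_ext_homogeneous[OF assms(1,3)]) (simp add: koszul_def)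
  have z: "homog_ext G x (\<lambda>e x'. koszul (parity d * parity e) (x' * 0)) = 0"
    unfolding homog_ext_def by (rule sum.neutral) (simp only: koszul_def mult_zero_right minus_zero if_cancel, simp)
  show ?thesis unfolding rmult_def
    by (rule trans, rule homog_ext_homogeneous, rule assms(1), rule assms(2), rule z, rule i)
qed

definition supercentralizer ::
  "('l::ab_group_add deg \<Rightarrow> 'a::{ring,monoid_mult} set) \<Rightarrow> 'a set \<Rightarrow> 'a set" where
  "supercentralizer G S = {a. \<forall>s\<in>S. a * s = rmult G a s}"


section \<open>Graded modules and bimodules\<close>

text \<open>
  Acting rings are passed separately, by their gradings, so that restricting or forgetting an
  action does not change the record.
\<close>

record ('l, 'r, 'm) gmod =
  grade :: "'l deg \<Rightarrow> 'm set"
  lact :: "'r \<Rightarrow> 'm \<Rightarrow> 'm"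

record ('l, 'r, 's, 'm) gbimod = "('l, 'r, 'm) gmod" +
  ract :: "'m \<Rightarrow> 's \<Rightarrow> 'm"

abbreviation elems :: "('l, 'r, 'm::ab_group_add, 'z) gmod_scheme \<Rightarrow> 'm set" where
  "elems M \<equiv> total (grade M)"

definition lmod_hom ::
  "('l deg \<Rightarrow> 'r::{ring,monoid_mult} set) \<Rightarrow> ('l, 'r, 'm::ab_group_add, 'y) gmod_scheme \<Rightarrow>
   ('l, 'r, 'n::ab_group_add, 'z) gmod_scheme \<Rightarrow> ('m \<Rightarrow> 'n) set" where
  "lmod_hom R M N = {f. additive_on (elems M) f \<and> (\<forall>d. f ` grade M d \<subseteq> grade N d) \<and>
     (\<forall>r\<in>total R. \<forall>x\<in>elems M. f (lact M r x) = lact N r (f x))}"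

definition bimod_hom ::
  "('l deg \<Rightarrow> 'r::{ring,monoid_mult} set) \<Rightarrow> ('l deg \<Rightarrow> 's::{ring,monoid_mult} set) \<Rightarrow>
   ('l, 'r, 's, 'm::ab_group_add, 'y) gbimod_scheme \<Rightarrow>
   ('l, 'r, 's, 'n::ab_group_add, 'z) gbimod_scheme \<Rightarrow> ('m \<Rightarrow> 'n) set" where
  "bimod_hom R S M N = {f \<in> lmod_hom R M N.
     \<forall>s\<in>total S. \<forall>x\<in>elems M. f (ract M x s) = ract N (f x) s}"

definition bimod_iso ::
  "('l deg \<Rightarrow> 'r::{ring,monoid_mult} set) \<Rightarrow> ('l deg \<Rightarrow> 's::{ring,monoid_mult} set) \<Rightarrow>
   ('l, 'r, 's, 'm::ab_group_add, 'y) gbimod_scheme \<Rightarrow>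
   ('l, 'r, 's, 'n::ab_group_add, 'z) gbimod_scheme \<Rightarrow> bool" where
  "bimod_iso R S M N \<longleftrightarrow> (\<exists>f\<in>bimod_hom R S M N. bij_betw f (elems M) (elems N))"

definition regular_bimod ::
  "('l deg \<Rightarrow> 'a::{ring,monoid_mult} set) \<Rightarrow> ('l, 'a, 'a, 'a) gbimod" where
  "regular_bimod G = \<lparr>grade = G, lact = (*), ract = (*)\<rparr>"

definition twist ::
  "('l deg \<Rightarrow> 'a::{ring,monoid_mult} set) \<Rightarrow> ('a \<Rightarrow> 'a) \<Rightarrow> ('a \<Rightarrow> 'a) \<Rightarrow>
   ('l, 'a, 'a, 'a) gbimod" where
  "twist G \<beta> \<alpha> = \<lparr>grade = G, lact = (\<lambda>b x. \<beta> b * x), ract = (\<lambda>x a. x * \<alpha> a)\<rparr>"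

definition shift ::
  "('l::ab_group_add deg \<Rightarrow> 'r::{ring,monoid_mult} set) \<Rightarrow> 'l \<Rightarrow> bit \<Rightarrow>
   ('l, 'r, 's, 'm::ab_group_add) gbimod \<Rightarrow> ('l, 'r, 's, 'm) gbimod" where
  "shift R \<mu> \<gamma> M =
     \<lparr>grade = (\<lambda>(\<nu>, \<delta>). grade M (\<nu> - \<mu>, \<delta> + \<gamma>)),
      lact = (\<lambda>a m. homog_ext R a (\<lambda>d a'. koszul (\<gamma> * parity d) (lact M a' m))),
      ract = ract M\<rparr>"


section \<open>Graded homomorphism bimodules\<close>

text \<open>
  \<open>HOM_part R M N d\<close> consists of the additive maps \<open>f\<close> of degree \<open>d = (\<mu>, \<gamma>)\<close> with
  \<open>f (b x) = (-1)\<^bsup>\<gamma> |b|\<^esup> b (f x)\<close>.  A map defined on \<open>elems M\<close> is represented by its extension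
  by zero; that clause is void for the modules with \<open>elems M = UNIV\<close>.
\<close>

definition HOM_part ::
  "('l::ab_group_add deg \<Rightarrow> 'r::{ring,monoid_mult} set) \<Rightarrow>
   ('l, 'r, 'm::ab_group_add, 'y) gmod_scheme \<Rightarrow>
   ('l, 'r, 'n::ab_group_add, 'z) gmod_scheme \<Rightarrow> 'l deg \<Rightarrow> ('m \<Rightarrow> 'n) set" where
  "HOM_part R M N d = {f. additive_on (elems M) f \<and> (\<forall>x. x \<notin> elems M \<longrightarrow> f x = 0) \<and>
     (\<forall>e. f ` grade M e \<subseteq> grade N (e + d)) \<and>
     (\<forall>e. \<forall>b\<in>R e. \<forall>x\<in>elems M.
        f (lact M b x) = koszul (parity d * parity e) (lact N b (f x)))}"

text \<open>
  For a bimodule \<open>M\<close> over \<open>(R, S)\<close> and a bimodule \<open>N\<close> over \<open>(R, T)\<close>, the following is a bimodule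
  over \<open>(S, T)\<close>, with
  \<open>(a f) x = (-1)\<^bsup>|a||f| + |a||x|\<^esup> f (x a)\<close> and \<open>(f b) x = (-1)\<^bsup>|b||x|\<^esup> (f x) b\<close>.
\<close>

definition HOM_bimod ::
  "('l::ab_group_add deg \<Rightarrow> 'r::{ring,monoid_mult} set) \<Rightarrow>
   ('l deg \<Rightarrow> 's::{ring,monoid_mult} set) \<Rightarrow> ('l deg \<Rightarrow> 't::{ring,monoid_mult} set) \<Rightarrow>
   ('l, 'r, 's, 'm::ab_group_add) gbimod \<Rightarrow> ('l, 'r, 't, 'n::ab_group_add) gbimod \<Rightarrow>
   ('l, 's, 't, 'm \<Rightarrow> 'n) gbimod" where
  "HOM_bimod R S T M N =
     \<lparr>grade = HOM_part R M N,
      lact = (\<lambda>a f x. homog_ext S a (\<lambda>d a'. homog_ext (HOM_part R M N) f (\<lambda>e f'.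
         homog_ext (grade M) x (\<lambda>g x'.
           koszul (parity d * parity e + parity d * parity g) (f' (ract M x' a')))))),
      ract = (\<lambda>f b x. homog_ext T b (\<lambda>d b'. homog_ext (grade M) x (\<lambda>g x'.
           koszul (parity d * parity g) (ract N (f x') b'))))\<rparr>"


section \<open>Finitely generated and projective modules\<close>

definition finitely_generated ::
  "('l deg \<Rightarrow> 'r::{ring,monoid_mult} set) \<Rightarrow> ('l, 'r, 'm::ab_group_add, 'z) gmod_scheme \<Rightarrow> bool"
  where
  "finitely_generated R M \<longleftrightarrow>
     (\<exists>S\<subseteq>elems M. finite S \<and>
        (\<forall>x\<in>elems M. \<exists>r. r ` S \<subseteq> total R \<and> x = (\<Sum>s\<in>S. lact M (r s) s)))"

text \<open>
  The free graded left module on a basis \<open>(e\<^sub>i)\<close>, \<open>i \<in> I\<close>, with \<open>e\<^sub>i\<close> homogeneous of degree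
  \<open>deg i\<close>; the element \<open>\<Sum> c\<^sub>i e\<^sub>i\<close> is represented by its coefficient function \<open>c\<close>.
\<close>

definition free_gmod ::
  "('l::ab_group_add deg \<Rightarrow> 'r::{ring,monoid_mult} set) \<Rightarrow> 'i set \<Rightarrow> ('i \<Rightarrow> 'l deg) \<Rightarrow>
   ('l, 'r, 'i \<Rightarrow> 'r) gmod" where
  "free_gmod R I deg =
     \<lparr>grade = (\<lambda>d. {c. finite {i. c i \<noteq> 0} \<and> (\<forall>i. i \<notin> I \<longrightarrow> c i = 0) \<and>
                       (\<forall>i\<in>I. c i \<in> R (d - deg i))}),
      lact = (\<lambda>r c i. r * c i)\<rparr>"

text \<open>
  Projective: direct summand of a free module.  Taking the basis indexed by a subset of the type
  of \<open>M\<close> is no restriction, since \<open>M\<close> is a quotient of the free module on its homogeneous elements,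
  and a projective module is a direct summand of any module of which it is a quotient.
\<close>

definition projective ::
  "('l::ab_group_add deg \<Rightarrow> 'r::{ring,monoid_mult} set) \<Rightarrow>
   ('l, 'r, 'm::ab_group_add, 'z) gmod_scheme \<Rightarrow> bool" where
  "projective R M \<longleftrightarrow>
     (\<exists>(I :: 'm set) deg. \<exists>i\<in>lmod_hom R M (free_gmod R I deg).
        \<exists>p\<in>lmod_hom R (free_gmod R I deg) M. \<forall>x\<in>elems M. p (i x) = x)"


section \<open>Twisted Frobenius extensions and trace maps\<close>

text \<open>
  \<open>frobenius_extension G B \<alpha> \<beta> l p\<close>: the ring graded by \<open>G\<close> is an \<open>(\<alpha>, \<beta>)\<close>-Frobenius extension
  of \<open>B\<close> of degree \<open>(-l, p)\<close>; note the sign of \<open>l\<close>, here and in \<open>trace_map\<close>.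
\<close>

definition frobenius_extension ::
  "('l::ab_group_add deg \<Rightarrow> 'a::{ring,monoid_mult} set) \<Rightarrow> 'a set \<Rightarrow> ('a \<Rightarrow> 'a) \<Rightarrow> ('a \<Rightarrow> 'a) \<Rightarrow>
   'l \<Rightarrow> bit \<Rightarrow> bool" where
  "frobenius_extension G B \<alpha> \<beta> l p \<longleftrightarrow>
     (let GB = sub_grading G B in
        finitely_generated GB (regular_bimod G) \<and> projective GB (regular_bimod G) \<and>
        bimod_iso G GB (regular_bimod G)
          (HOM_bimod GB G GB (twist G \<beta> \<alpha>) (shift GB l p (regular_bimod GB))))"

definition trace_map ::
  "('l::ab_group_add deg \<Rightarrow> 'a::{ring,monoid_mult} set) \<Rightarrow> 'a set \<Rightarrow> ('a \<Rightarrow> 'a) \<Rightarrow> ('a \<Rightarrow> 'a) \<Rightarrow>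
   'l \<Rightarrow> bit \<Rightarrow> ('a \<Rightarrow> 'a) \<Rightarrow> bool" where
  "trace_map G B \<alpha> \<beta> l p tr \<longleftrightarrow>
     (let GB = sub_grading G B; BB = shift GB l p (regular_bimod GB) in
        tr \<in> bimod_hom GB GB (twist G \<beta> \<alpha>) BB \<and>
        (\<forall>a. (\<forall>x. tr (x * a) = 0) \<longrightarrow> a = 0) \<and>
        (\<forall>\<phi>\<in>total (HOM_part GB (twist G \<beta> \<alpha>) BB). \<exists>a. \<phi> = tr \<circ> rmult G a))"

end

theory Submission
  imports Defs "HOL.Modules"
begin

text \<open>
  By (L4), \<open>tr' = tr \<circ> rmult G a\<close> for some \<open>a\<close>; comparing degrees, (L3) kills every component of
  \<open>a\<close> of nonzero degree.  Right linearity of \<open>tr\<close> and \<open>tr'\<close> gives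
  \<open>tr (x * (\<alpha> b * a - a * \<alpha> b)) = 0\<close> for all \<open>x\<close>, so \<open>a\<close> centralizes \<open>\<alpha> ` B\<close> by (L3), and
  exchanging the roles of \<open>tr\<close> and \<open>tr'\<close> yields an inverse of \<open>a\<close>.
\<close>

section \<open>Additive maps and signs\<close>

lemma additive_on_UNIV: "additive_on UNIV f \<longleftrightarrow> additive f"
  by (simp add: additive_on_def additive_def)

lemma koszul_0 [simp]: "koszul 0 v = v"
  by (simp add: koszul_def)

lemma koszul_zero_right [simp]: "koszul \<gamma> 0 = 0"
  by (simp add: koszul_def)

lemma koszul_eq_0_iff [simp]: "koszul \<gamma> v = 0 \<longleftrightarrow> v = 0"
  by (simp add: koszul_def)

lemma koszul_mult: "koszul \<gamma> v * w = koszul \<gamma> (v * w)" for v w :: "'a::ring"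
  by (simp add: koszul_def)

lemma additive_koszul: "additive f \<Longrightarrow> f (koszul \<gamma> v) = koszul \<gamma> (f v)"
  by (simp add: koszul_def additive.minus)

lemma homog_ext_zero: "(\<And>d y. F d y = 0) \<Longrightarrow> homog_ext G x F = 0"
  by (simp add: homog_ext_def)


section \<open>Homogeneous components\<close>

text \<open>\<open>D\<close> only has to contain the support of \<open>c\<close>, so it can be
  chosen conveniently, for example as a singleton or the image of an index set.\<close>

lemma decompositionI:
  assumes "\<And>d. c d \<in> G d" "finite D" "\<And>d. d \<notin> D \<Longrightarrow> c d = 0" "x = sum c D"
  shows "decomposition G x c"
proof -
  have s: "{d. c d \<noteq> 0} \<subseteq> D" using assms(3) by blast
  then have "sum c D = (\<Sum>d | c d \<noteq> 0. c d)"
    by (intro sum.mono_neutral_right) (use assms(2) in auto)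
  then show ?thesis
    using assms(1,4) finite_subset[OF s assms(2)] by (simp add: decomposition_def)
qed

lemma hcomp_decomposition:
  assumes "graded_group G" "decomposition G x c"
  shows "hcomp G d x = c d"
proof -
  have t: "x \<in> total G" using assms(2) by (auto simp: total_def)
  then have "\<exists>!c. decomposition G x c" using assms(1) unfolding graded_group_def by blast
  then have "(THE c. decomposition G x c) = c"
    using assms(2) by (simp add: the1_equality)
  then show ?thesis using t by (simp add: hcomp_def)
qed

lemma decomposition_hcomp:
  assumes "graded_group G" "x \<in> total G"
  shows "decomposition G x (\<lambda>d. hcomp G d x)"
proof -
  obtain c where c: "decomposition G x c" using assms(2) by (auto simp: total_def)
  then have "(\<lambda>d. hcomp G d x) = c" using hcomp_decomposition[OF assms(1)] by blast
  then show ?thesis using c by simp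
qed

lemma finite_hcomp: "graded_group G \<Longrightarrow> x \<in> total G \<Longrightarrow> finite {d. hcomp G d x \<noteq> 0}"
  using decomposition_hcomp[of G x] by (simp add: decomposition_def)

lemma hcomp_in: "graded_group G \<Longrightarrow> x \<in> total G \<Longrightarrow> hcomp G d x \<in> G d"
  using decomposition_hcomp[of G x] by (simp add: decomposition_def)

lemma sum_hcomp: "graded_group G \<Longrightarrow> x \<in> total G \<Longrightarrow> (\<Sum>d | hcomp G d x \<noteq> 0. hcomp G d x) = x"
  using decomposition_hcomp[of G x] by (simp add: decomposition_def)

lemma zero_in_graded_group: "graded_group G \<Longrightarrow> 0 \<in> G d"
  by (simp add: graded_group_def)

lemma uminus_in_graded_group: "graded_group G \<Longrightarrow> x \<in> G d \<Longrightarrow> - x \<in> G d"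
  unfolding graded_group_def by (metis diff_0)

lemma koszul_in_graded_group: "graded_group G \<Longrightarrow> x \<in> G d \<Longrightarrow> koszul \<gamma> x \<in> G d"
  by (simp add: koszul_def uminus_in_graded_group)

text \<open>Since \<open>s\<close> is injective, the terms lie in different degrees and are
  therefore the homogeneous components of the sum; a sum of degree \<open>e\<close> has no component
  elsewhere.\<close>

lemma homogeneous_sum_vanish:
  assumes G: "graded_group G" and D: "finite D" "inj_on s D"
    and f: "\<And>d. d \<in> D \<Longrightarrow> f d \<in> G (s d)"
    and e: "sum f D \<in> G e" and d: "d \<in> D" "s d \<noteq> e"
  shows "f d = 0"
proof -
  \<comment> \<open>Reindexes the terms by their degree: \<open>c k\<close> is the only term of
    degree \<open>k\<close>, and zero if there is none.\<close>
  define c where "c k = (if k \<in> s ` D then f (the_inv_into D s k) else 0)" for k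
  have cs: "c (s k) = f k" if "k \<in> D" for k
    using that D(2) by (simp add: c_def the_inv_into_f_f)
  have "decomposition G (sum f D) c"
  proof (rule decompositionI)
    show "c k \<in> G k" for k
      using f cs zero_in_graded_group[OF G] by (cases "k \<in> s ` D") (auto simp: c_def)
    show "sum f D = sum c (s ` D)"
      using D(2) cs by (simp add: sum.reindex)
  qed (use D in \<open>auto simp: c_def\<close>)
  then have "f d = hcomp G (s d) (sum f D)"
    using hcomp_decomposition[OF G] cs d(1) by metis
  also have "\<dots> = 0" using hcomp_homogeneous[OF G e] d(2) by simp
  finally show ?thesis .
qed

text \<open>Serves to extend a degree argument from homogeneous \<open>x\<close> to all
  \<open>x\<close>, as (L3) requires.\<close>

lemma additive_eq_0_if_homogeneous:
  assumes G: "graded_group G" and x: "x \<in> total G" and f: "additive f"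
    and z: "\<And>d y. y \<in> G d \<Longrightarrow> f y = 0"
  shows "f x = 0"
proof -
  have "f x = f (\<Sum>d | hcomp G d x \<noteq> 0. hcomp G d x)" by (simp add: sum_hcomp[OF G x])
  also have "\<dots> = 0" using z[OF hcomp_in[OF G x]] by (simp add: additive.sum[OF f])
  finally show ?thesis .
qed


section \<open>Signed right multiplication\<close>

lemma graded_superringD:
  assumes "graded_superring G"
  shows "graded_group G" "total G = UNIV" "1 \<in> G 0"
    "x \<in> G d \<Longrightarrow> y \<in> G e \<Longrightarrow> x * y \<in> G (d + e)"
  using assms unfolding graded_superring_def by blast+

text \<open>All signs are trivial for \<open>a\<close> of degree zero, and the components of
  \<open>x\<close> add up to \<open>x\<close> again.\<close>

lemma rmult_degree_zero:
  fixes G :: "'l::ab_group_add deg \<Rightarrow> 'a::{ring,monoid_mult} set"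
  assumes "graded_superring G" "a \<in> G 0"
  shows "rmult G a x = x * a"
proof -
  note G = graded_superringD[OF assms(1)]
  have "rmult G a x =
      homog_ext G x (\<lambda>e x'. koszul (parity (0 :: 'l deg) * parity e) (x' * a))"
    unfolding rmult_def
    by (rule homog_ext_homogeneous[OF G(1) assms(2)]) (simp add: homog_ext_zero)
  also have "\<dots> = (\<Sum>d | hcomp G d x \<noteq> 0. hcomp G d x) * a"
    by (simp add: homog_ext_def sum_distrib_right)
  also have "\<dots> = x * a" using sum_hcomp[OF G(1)] G(2) by simp
  finally show ?thesis .
qed

lemma hcomp_mult_degree_zero:
  assumes "graded_superring G" "a \<in> G 0"
  shows "hcomp G d (c * a) = hcomp G d c * a"
proof -
  note G = graded_superringD[OF assms(1)]
  have c: "c \<in> total G" using G(2) by simp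
  have "decomposition G (c * a) (\<lambda>d. hcomp G d c * a)"
  proof (rule decompositionI)
    show "hcomp G d c * a \<in> G d" for d
      using G(4)[OF hcomp_in[OF G(1) c] assms(2)] by simp
    show "c * a = (\<Sum>d | hcomp G d c \<noteq> 0. hcomp G d c * a)"
      using sum_hcomp[OF G(1) c] by (simp flip: sum_distrib_right)
  qed (use finite_hcomp[OF G(1) c] in auto)
  then show ?thesis by (rule hcomp_decomposition[OF G(1)])
qed

text \<open>Right multiplication by \<open>a\<close> keeps the degree of each component of
  \<open>c\<close>, hence every sign. This lets a factor be absorbed when (L4) is
  transferred.\<close>

lemma rmult_mult_degree_zero:
  fixes G :: "'l::ab_group_add deg \<Rightarrow> 'a::{ring,monoid_mult} set"
  assumes "graded_superring G" "a \<in> G 0"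
  shows "rmult G (c * a) x = rmult G c x * a"
proof -
  note G = graded_superringD[OF assms(1)]
  have c: "c \<in> total G" using G(2) by simp
  let ?F = "\<lambda>d a'. homog_ext G x (\<lambda>e x'. koszul (parity d * parity e) (x' * a'))"
  have F: "?F d (a' * a) = ?F d a' * a" for d a'
    by (simp add: homog_ext_def sum_distrib_right koszul_mult mult.assoc)
  have "rmult G (c * a) x = (\<Sum>d | hcomp G d c * a \<noteq> 0. ?F d (hcomp G d c * a))"
    by (simp add: rmult_def homog_ext_def[of G "c * a"] hcomp_mult_degree_zero[OF assms])
  \<comment> \<open>Some components of \<open>c\<close> may be killed by \<open>a\<close>; the terms
    added here are \<open>?F d 0 = 0\<close>.\<close>
  also have "\<dots> = (\<Sum>d | hcomp G d c \<noteq> 0. ?F d (hcomp G d c * a))"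
    using finite_hcomp[OF G(1) c]
    by (intro sum.mono_neutral_left) (auto simp: homog_ext_zero)
  also have "\<dots> = rmult G c x * a"
    by (simp only: F rmult_def homog_ext_def[of G c] sum_distrib_right)
  finally show ?thesis .
qed

text \<open>Only \<open>x\<close> is homogeneous here, because (L4) supplies an \<open>a\<close> of
  which no degree is known.\<close>

lemma rmult_homogeneous_right:
  fixes G :: "'l::ab_group_add deg \<Rightarrow> 'a::{ring,monoid_mult} set"
  assumes "graded_superring G" "x \<in> G e"
  shows "rmult G a x =
    (\<Sum>d | hcomp G d a \<noteq> 0. koszul (parity d * parity e) (x * hcomp G d a))"
proof -
  note G = graded_superringD[OF assms(1)]
  have "homog_ext G x (\<lambda>e x'. koszul (parity d * parity e) (x' * a')) =
      koszul (parity d * parity e) (x * a')" for d :: "'l deg" and a'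
    by (rule homog_ext_homogeneous[OF G(1) assms(2)]) simp
  then show ?thesis by (simp add: rmult_def homog_ext_def[of G a])
qed


section \<open>Trace maps\<close>

text \<open>In \<open>bit\<close> addition and subtraction agree, so both coordinates of the shift
  become one subtraction.\<close>

lemma grade_shift_regular:
  "grade (shift R l p (regular_bimod R)) d = R (d - (l, p))"
  by (cases d) (simp add: shift_def regular_bimod_def)

lemma trace_mapD:
  assumes G: "graded_superring G" and B: "graded_subring G B"
    and tr: "trace_map G B \<alpha> \<beta> l p tr"
  shows "additive tr"
    and "x \<in> G d \<Longrightarrow> tr x \<in> G (d - (l, p))"
    and "b \<in> B \<Longrightarrow> tr (x * \<alpha> b) = tr x * b"
    and "(\<And>x. tr (x * a) = 0) \<Longrightarrow> a = 0"
proof -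
  note U = graded_superringD(2)[OF G]
  have T: "total (sub_grading G B) = B" using B by (simp add: graded_subring_def)
  show "additive tr" using tr U
    by (simp add: trace_map_def bimod_hom_def lmod_hom_def twist_def Let_def additive_on_UNIV)
  have "\<forall>d. tr ` G d \<subseteq> sub_grading G B (d - (l, p))" using tr
    unfolding trace_map_def bimod_hom_def lmod_hom_def twist_def Let_def grade_shift_regular
    by simp
  then show "x \<in> G d \<Longrightarrow> tr x \<in> G (d - (l, p))"
    unfolding sub_grading_def by blast
  show "b \<in> B \<Longrightarrow> tr (x * \<alpha> b) = tr x * b" using tr U T
    by (simp add: trace_map_def bimod_hom_def twist_def Let_def shift_def regular_bimod_def)
  show "(\<And>x. tr (x * a) = 0) \<Longrightarrow> a = 0" using tr
    by (simp add: trace_map_def Let_def)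
qed

text \<open>A trace map has degree zero, so the sign in \<open>HOM_part\<close> disappears and left
  linearity suffices. Hence (L4) for one trace map applies to any other.\<close>

lemma trace_map_in_total_HOM_part:
  fixes G :: "'l::ab_group_add deg \<Rightarrow> 'a::{ring,monoid_mult} set"
  assumes G: "graded_superring G" and B: "graded_subring G B"
    and tr: "trace_map G B \<alpha> \<beta> l p tr"
  defines "GB \<equiv> sub_grading G B"
  defines "H \<equiv> HOM_part GB (twist G \<beta> \<alpha>) (shift GB l p (regular_bimod GB))"
  shows "tr \<in> total H"
proof -
  note U = graded_superringD(1,2)[OF G]
  have T: "total GB = B" using B by (simp add: graded_subring_def GB_def)
  \<comment> \<open>Closure under differences puts zero into \<open>B\<close>; the zero map must lie
    in every \<open>H d\<close> to serve as the component of \<open>tr\<close> in nonzero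
    degrees.\<close>
  have "1 - 1 \<in> B" using B unfolding graded_subring_def by blast
  then have "0 \<in> GB d" for d
    using zero_in_graded_group[OF U(1)] by (simp add: GB_def sub_grading_def)
  moreover have "lact (shift GB l p (regular_bimod GB)) b 0 = 0" for b
    by (simp add: shift_def regular_bimod_def homog_ext_zero)
  ultimately have z: "(\<lambda>x. 0) \<in> H d" for d
    using U(2) unfolding H_def HOM_part_def additive_on_def grade_shift_regular
    by (simp add: twist_def image_subset_iff)
  have h: "tr \<in> H 0"
    using tr U(2) T unfolding H_def HOM_part_def trace_map_def bimod_hom_def lmod_hom_def
    by (auto simp: twist_def Let_def GB_def sub_grading_def)
  have "decomposition H tr (\<lambda>d. if d = 0 then tr else (\<lambda>x. 0))"
    by (rule decompositionI[where D = "{0}"]) (use h z in \<open>auto simp: zero_fun_def\<close>)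
  then show ?thesis by (auto simp: total_def)
qed

text \<open>The two trace maps can be exchanged, which later gives the passage back from
  \<open>tr'\<close> to \<open>tr\<close>. Degree zero frees the last equation from signs.\<close>

lemma trace_map_transition:
  fixes G :: "'l::ab_group_add deg \<Rightarrow> 'a::{ring,monoid_mult} set"
  assumes G: "graded_superring G" and B: "graded_subring G B"
    and tr: "trace_map G B \<alpha> \<beta> l p tr" and tr': "trace_map G B \<alpha> \<beta> l p tr'"
  obtains a where "a \<in> G 0" "tr' = tr \<circ> rmult G a" "\<And>x. tr' x = tr (x * a)"
proof -
  note gr = graded_superringD[OF G] and t = trace_mapD[OF G B tr] and t' = trace_mapD[OF G B tr']
  obtain a where a: "tr' = tr \<circ> rmult G a"
    using tr trace_map_in_total_HOM_part[OF G B tr'] unfolding trace_map_def Let_def by blast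
  have aT: "a \<in> total G" using gr(2) by simp
  let ?D = "{d. hcomp G d a \<noteq> 0}"
  have z: "hcomp G d a = 0" if "d \<noteq> 0" for d
  proof (rule ccontr)
    assume nz: "hcomp G d a \<noteq> 0"
    have "tr (x * hcomp G d a) = 0" if x: "x \<in> G e" for x e
    proof -
      let ?f = "\<lambda>d. koszul (parity d * parity e) (tr (x * hcomp G d a))"
      have "?f d = 0"
      \<comment> \<open>The terms sum to \<open>tr' x\<close>, of degree \<open>e - (l, p)\<close>,
        whereas the term for \<open>d\<close> has degree \<open>e + d - (l, p)\<close>; these differ
        as \<open>d\<close> is nonzero.\<close>
      proof (rule homogeneous_sum_vanish[OF gr(1), where f = ?f and D = ?D
            and s = "\<lambda>d. e + d - (l, p)" and e = "e - (l, p)"])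
        show "?f d \<in> G (e + d - (l, p))" for d
          by (intro koszul_in_graded_group gr(1) t(2) gr(4) x hcomp_in aT)
        have "sum ?f ?D = tr' x"
          by (simp add: a rmult_homogeneous_right[OF G x] additive.sum[OF t(1)]
              additive_koszul[OF t(1)])
        then show "sum ?f ?D \<in> G (e - (l, p))" using t'(2)[OF x] by simp
      qed (use nz that \<open>d \<noteq> 0\<close> finite_hcomp[OF gr(1) aT] in \<open>auto simp: inj_on_def\<close>)
      then show ?thesis by simp
    qed
    moreover have "additive (\<lambda>x. tr (x * hcomp G d a))"
      using t(1) by (simp add: additive_def distrib_right)
    ultimately have "tr (x * hcomp G d a) = 0" for x
      using additive_eq_0_if_homogeneous[OF gr(1), of x "\<lambda>x. tr (x * hcomp G d a)"] gr(2) by auto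
    then show False using t(4) nz by blast
  qed
  have "a = (\<Sum>d | hcomp G d a \<noteq> 0. hcomp G d a)" by (simp add: sum_hcomp[OF gr(1) aT])
  also have "\<dots> = (\<Sum>d\<in>{0}. hcomp G d a)"
    by (rule sum.mono_neutral_left) (use z in auto)
  finally have "a \<in> G 0" using hcomp_in[OF gr(1) aT, of 0] by simp
  then show thesis using that a rmult_degree_zero[OF G] by simp
qed

lemma trace_map_comp_rmult:
  fixes G :: "'l::ab_group_add deg \<Rightarrow> 'a::{ring,monoid_mult} set"
  assumes G: "graded_superring G" and B: "graded_subring G B"
    and tr: "trace_map G B \<alpha> \<beta> l p tr"
    and a: "a \<in> supercentralizer G (\<alpha> ` B)" "a \<in> G 0" "a * a' = 1" "a' * a = 1"
  shows "trace_map G B \<alpha> \<beta> l p (tr \<circ> rmult G a)"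
proof -
  note gr = graded_superringD[OF G] and t = trace_mapD[OF G B tr]
  let ?GB = "sub_grading G B"
  let ?BB = "shift ?GB l p (regular_bimod ?GB)"
  have T: "total ?GB = B" using B by (simp add: graded_subring_def)
  have r: "rmult G a x = x * a" for x by (rule rmult_degree_zero[OF G a(2)])
  \<comment> \<open>In degree zero supercommuting is plain commuting.\<close>
  have comm: "\<alpha> b * a = a * \<alpha> b" if "b \<in> B" for b
    using a(1) that by (simp add: supercentralizer_def r)
  have xa: "x * a \<in> G d" if "x \<in> G d" for x d using gr(4)[OF that a(2)] by simp
  have "tr \<circ> rmult G a \<in> bimod_hom ?GB ?GB (twist G \<beta> \<alpha>) ?BB"
  proof -
    have hom: "tr \<in> bimod_hom ?GB ?GB (twist G \<beta> \<alpha>) ?BB"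
      using tr by (simp add: trace_map_def Let_def)
    have deg: "tr x \<in> grade ?BB d" if "x \<in> G d" for x d
    proof -
      have "\<forall>d. tr ` grade (twist G \<beta> \<alpha>) d \<subseteq> grade ?BB d"
        using hom unfolding bimod_hom_def lmod_hom_def by blast
      then show ?thesis using that by (auto simp: twist_def simp del: split_paired_All)
    qed
    have left: "tr (\<beta> b * x) = lact ?BB b (tr x)" if "b \<in> B" for b x
      using hom that gr(2) T by (simp add: bimod_hom_def lmod_hom_def twist_def)
    have right: "tr (x * \<alpha> b * a) = ract ?BB (tr (x * a)) b" if "b \<in> B" for b x
      using t(3)[OF that, of "x * a"] comm[OF that]
      by (simp add: shift_def regular_bimod_def mult.assoc)
    have add: "tr ((x + y) * a) = tr (x * a) + tr (y * a)" for x y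
      by (simp add: distrib_right additive.add[OF t(1)])
    have left': "tr (\<beta> b * x * a) = lact ?BB b (tr (x * a))" if "b \<in> B" for b x
      using left[OF that, of "x * a"] by (simp add: mult.assoc)
    have "\<forall>d. (\<lambda>x. tr (x * a)) ` G d \<subseteq> grade ?BB d"
      using deg[OF xa] by blast
    then show ?thesis
      unfolding bimod_hom_def lmod_hom_def additive_on_def T
      by (simp add: twist_def gr(2) r add left' right o_def del: split_paired_All)
  qed
  moreover have "c = 0" if "\<forall>x. (tr \<circ> rmult G a) (x * c) = 0" for c
  proof -
    have "c * a = 0" by (rule t(4)) (use that in \<open>simp add: r mult.assoc\<close>)
    then have "c * a * a' = 0" by simp
    then show "c = 0" using a(3) by (simp add: mult.assoc)
  qed
  moreover have "\<exists>c. \<phi> = tr \<circ> rmult G a \<circ> rmult G c"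
    if "\<phi> \<in> total (HOM_part ?GB (twist G \<beta> \<alpha>) ?BB)" for \<phi>
  proof -
    have "\<forall>\<phi>\<in>total (HOM_part ?GB (twist G \<beta> \<alpha>) ?BB). \<exists>c. \<phi> = tr \<circ> rmult G c"
      using tr by (simp add: trace_map_def Let_def)
    from bspec[OF this that] obtain c where c: "\<phi> = tr \<circ> rmult G c" ..
    \<comment> \<open>Precomposing \<open>tr \<circ> rmult G a\<close> with \<open>rmult G d\<close>
      gives \<open>tr \<circ> rmult G (d * a)\<close>; solving \<open>d * a = c\<close> leads to the
      witness \<open>c * a'\<close>.\<close>
    have "rmult G (c * a') x * a = rmult G c x" for x
      using rmult_mult_degree_zero[OF G a(2), of "c * a'" x] a(4) by (simp add: mult.assoc)
    then have "\<phi> = tr \<circ> rmult G a \<circ> rmult G (c * a')"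
      unfolding c by (simp add: fun_eq_iff r)
    then show ?thesis ..
  qed
  ultimately show ?thesis by (simp add: trace_map_def Let_def)
qed

theorem proposition4p7:
  fixes G :: "'l::ab_group_add \<times> bit \<Rightarrow> 'a::{ring,monoid_mult} set"
    and B :: "'a set" and \<alpha> \<beta> tr tr' :: "'a \<Rightarrow> 'a" and l :: 'l and p :: bit
  assumes "graded_superring G" and "graded_subring G B"
    and "graded_automorphism G \<alpha>" and "graded_automorphism (sub_grading G B) \<beta>"
    and "frobenius_extension G B \<alpha> \<beta> l p"
    and "trace_map G B \<alpha> \<beta> l p tr"
  shows "trace_map G B \<alpha> \<beta> l p tr' \<longleftrightarrow>
    (\<exists>a \<in> supercentralizer G (\<alpha> ` B).
       a \<in> G 0 \<and> (\<exists>a'. a * a' = 1 \<and> a' * a = 1) \<and> tr' = tr \<circ> rmult G a)"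
proof
  note G = assms(1) and B = assms(2) and tr = assms(6)
  note t = trace_mapD[OF G B tr]
  assume tr': "trace_map G B \<alpha> \<beta> l p tr'"
  note t' = trace_mapD[OF G B tr']
  obtain a where a: "a \<in> G 0" "tr' = tr \<circ> rmult G a" "\<And>x. tr' x = tr (x * a)"
    using trace_map_transition[OF G B tr tr'] by blast
  obtain a' where a': "\<And>x. tr x = tr' (x * a')"
    using trace_map_transition[OF G B tr' tr] by blast
  \<comment> \<open>Each transition formula is substituted into the other. (L3) for
    \<open>tr\<close> will give \<open>a' * a = 1\<close>, and (L3) for \<open>tr'\<close> will give
    \<open>a * a' = 1\<close>.\<close>
  have "tr (x * (a' * a)) = tr x" "tr' (x * (a * a')) = tr' x" for x
    using a(3)[of "x * a'"] a'[of x] a'[of "x * a"] a(3)[of x] by (simp_all add: mult.assoc)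
  then have "tr (x * (a' * a - 1)) = 0" "tr' (x * (a * a' - 1)) = 0" for x
    by (simp_all add: right_diff_distrib additive.diff[OF t(1)] additive.diff[OF t'(1)])
  then have "a' * a - 1 = 0" "a * a' - 1 = 0"
    using t(4) t'(4) by blast+
  moreover have "a * \<alpha> b - \<alpha> b * a = 0" if b: "b \<in> B" for b
  proof (rule t(4))
    fix x
    \<comment> \<open>Both products have trace \<open>tr' x * b\<close>: one by right linearity of
      \<open>tr\<close> at \<open>x * a\<close>, the other by that of \<open>tr'\<close> at
      \<open>x\<close>.\<close>
    have "tr (x * (a * \<alpha> b)) = tr (x * a) * b"
      using t(3)[OF b, of "x * a"] by (simp add: mult.assoc)
    also have "\<dots> = tr (x * (\<alpha> b * a))"
      using t'(3)[OF b, of x] a(3) by (simp add: mult.assoc)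
    finally show "tr (x * (a * \<alpha> b - \<alpha> b * a)) = 0"
      by (simp add: right_diff_distrib additive.diff[OF t(1)])
  qed
  then have "a \<in> supercentralizer G (\<alpha> ` B)"
    by (auto simp: supercentralizer_def rmult_degree_zero[OF G a(1)])
  ultimately show "\<exists>a \<in> supercentralizer G (\<alpha> ` B).
      a \<in> G 0 \<and> (\<exists>a'. a * a' = 1 \<and> a' * a = 1) \<and> tr' = tr \<circ> rmult G a"
    using a by auto
next
  assume "\<exists>a \<in> supercentralizer G (\<alpha> ` B).
      a \<in> G 0 \<and> (\<exists>a'. a * a' = 1 \<and> a' * a = 1) \<and> tr' = tr \<circ> rmult G a"
  then show "trace_map G B \<alpha> \<beta> l p tr'"
    using trace_map_comp_rmult[OF assms(1,2,6)] by blast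
qed

end
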